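(* For every positive integer $n$ and every positive integer $r$, $$a_n^C(FS_r)=\sum_{j=1}^n\left(\left(\sum_{k=j}^n(-1)^{k-j}\binom{k}{j}\frac{|T_{n,k}|}{k!}\right)j^r\right).$$
   Context: $FS_r$ is the free semigroup of rank $r$, i.e. all non-empty words over an alphabet of $r$ letters under concatenation. $a_n^C(FS_r)$ denotes the number of (two-sided) congruences on $FS_r$ with precisely $n$ non-empty congruence classes. Let $W_n=\{w_1<w_2<\dots<w_n\}$ be a fixed totally ordered $n$-element set. For $1\le k\le n$, let $C_{n,k}$ be the set of all semigroup Cayley tables $(W_n,\otimes)$ (i.e. associative binary operations $\otimes$ on $W_n$, counted up to equality) for which the semigroup $(W_n,\otimes)$ is generated (not necessarily minimally) by $\{w_1,\dots,w_k\}$. For $(W_n,\otimes)\in C_{n,k}$ and $w\in W_n$, let $\mathrm{dec}(w)$ be the smallest decomposition of $w$ as a $\otimes$-product of elements of $\{w_1,\dots,w_k\}$, where decompositions are regarded as words over the alphabet $w_1<\dots<w_k$ and compared in the shortlex order $<_\otimes$ (first by length, then lexicographically). $(W_n,\otimes)$ is ascendingly generated by $\{w_1,\dots,w_k\}$ if it lies in $C_{n,k}$ and $\mathrm{dec}(w_{k+1})<_\otimes \mathrm{dec}(w_{k+2})<_\otimes\dots<_\otimes \mathrm{dec}(w_n)$. $T_{n,k}$ denotes the set of all $(W_n,\otimes)\in C_{n,k}$ ascendingly generated by $\{w_1,\dots,w_k\}$. *)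

theory Defs
  imports Complex_Main "HOL-Library.FuncSet" "HOL-Library.List_Lenlexorder"
begin

definition free_semigroup :: "nat \<Rightarrow> nat list set" where
  "free_semigroup r = lists {1..r} - {[]}"

definition congruence_on :: "'a set \<Rightarrow> ('a \<Rightarrow> 'a \<Rightarrow> 'a) \<Rightarrow> ('a \<times> 'a) set \<Rightarrow> bool" where
  "congruence_on S m \<rho> \<longleftrightarrow> equiv S \<rho> \<and>
     (\<forall>(x, y) \<in> \<rho>. \<forall>z \<in> S. (m z x, m z y) \<in> \<rho> \<and> (m x z, m y z) \<in> \<rho>)"

definition congruence_growth :: "nat \<Rightarrow> nat \<Rightarrow> nat" where
  "congruence_growth r n =
     card {\<rho>. congruence_on (free_semigroup r) (@) \<rho> \<and> card (free_semigroup r // \<rho>) = n}"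

text \<open>
  We take \<open>W\<^sub>n = {1..n}\<close> with \<open>w\<^sub>i = i\<close>. Operations on it are extensional functions
  (\<open>undefined\<close> outside \<open>W\<^sub>n\<close>), so that two tables are equal as functions
  exactly if all their entries agree.
\<close>

definition semigroup_tables :: "nat \<Rightarrow> (nat \<Rightarrow> nat \<Rightarrow> nat) set" where
  "semigroup_tables n = {m \<in> {1..n} \<rightarrow>\<^sub>E {1..n} \<rightarrow>\<^sub>E {1..n}.
     \<forall>x\<in>{1..n}. \<forall>y\<in>{1..n}. \<forall>z\<in>{1..n}. m (m x y) z = m x (m y z)}"

inductive_set subsemigroup_generated :: "('a \<Rightarrow> 'a \<Rightarrow> 'a) \<Rightarrow> 'a set \<Rightarrow> 'a set"
  for m :: "'a \<Rightarrow> 'a \<Rightarrow> 'a" and A :: "'a set" where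
  incl: "a \<in> A \<Longrightarrow> a \<in> subsemigroup_generated m A"
| mult: "\<lbrakk>x \<in> subsemigroup_generated m A; y \<in> subsemigroup_generated m A\<rbrakk>
         \<Longrightarrow> m x y \<in> subsemigroup_generated m A"

definition C_tables :: "nat \<Rightarrow> nat \<Rightarrow> (nat \<Rightarrow> nat \<Rightarrow> nat) set" where
  "C_tables n k = {m \<in> semigroup_tables n. subsemigroup_generated m {1..k} = {1..n}}"

text \<open>Only meaningful on non-empty words.\<close>

definition word_product :: "('a \<Rightarrow> 'a \<Rightarrow> 'a) \<Rightarrow> 'a list \<Rightarrow> 'a" where
  "word_product m u = foldl m (hd u) (tl u)"

text \<open>
  The order on \<open>nat list\<close> is the one of \<^theory>\<open>HOL-Library.List_Lenlexorder\<close>: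
  first by length, then lexicographically, i.e. shortlex.
\<close>

definition dec :: "(nat \<Rightarrow> nat \<Rightarrow> nat) \<Rightarrow> nat \<Rightarrow> nat \<Rightarrow> nat list" where
  "dec m k w = (LEAST u. u \<noteq> [] \<and> set u \<subseteq> {1..k} \<and> word_product m u = w)"

definition T_tables :: "nat \<Rightarrow> nat \<Rightarrow> (nat \<Rightarrow> nat \<Rightarrow> nat) set" where
  "T_tables n k = {m \<in> C_tables n k. \<forall>i. k < i \<and> i < n \<longrightarrow> dec m k i < dec m k (Suc i)}"

end

theory Submission
  imports Defs "HOL-Combinatorics.Permutations"
begin

text \<open>
  Fix a surjection \<open>f\<close> from the \<open>r\<close> letters onto \<open>{1..k}\<close>. Evaluating the
  \<open>f\<close>-image of a word in a table of \<open>T_tables n k\<close> gives a congruence with \<open>n\<close> classes that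
  identifies two letters iff \<open>f\<close> does. Conversely, such a congruence arises from exactly one
  ascendingly generated table, because the numbering of its classes is forced: each class is numbered by
  the shortlex rank of its least word over \<open>{1..k}\<close>. A congruence with \<open>k\<close> classes of letters
  belongs to \<open>k!\<close> surjections, so there are \<open>Surj(r, k) |T_tables n k| / k!\<close> of them, and
  inclusion-exclusion for the number \<open>Surj(r, k)\<close> of surjections gives the formula.
\<close>

section \<open>Kernels of maps\<close>

definition kernel_on :: "'a set \<Rightarrow> ('a \<Rightarrow> 'b) \<Rightarrow> ('a \<times> 'a) set" where
  "kernel_on A f = {(x, y) \<in> A \<times> A. f x = f y}"

lemma kernel_on_iff [simp]: "(x, y) \<in> kernel_on A f \<longleftrightarrow> x \<in> A \<and> y \<in> A \<and> f x = f y"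
  by (simp add: kernel_on_def)

lemma equiv_kernel_on: "equiv A (kernel_on A f)"
  by (rule equivI) (auto simp: refl_on_def sym_def trans_def kernel_on_def)

lemma equiv_eq_kernel_on:
  assumes "equiv A R" and "\<And>x y. x \<in> A \<Longrightarrow> y \<in> A \<Longrightarrow> (x, y) \<in> R \<longleftrightarrow> f x = f y"
  shows "R = kernel_on A f"
  using assms(2) equiv_type[OF assms(1)] by auto

lemma kernel_on_eq_iff:
  "kernel_on A f = kernel_on A g \<longleftrightarrow> (\<forall>x\<in>A. \<forall>y\<in>A. f x = f y \<longleftrightarrow> g x = g y)"
  by (auto simp: set_eq_iff)

text \<open>The classes are the non-empty fibres, indexed by the values attained.\<close>

lemma bij_betw_quotient_kernel_on:
  "bij_betw (\<lambda>y. {x \<in> A. f x = y}) (f ` A) (A // kernel_on A f)"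
proof -
  have "kernel_on A f `` {x} = {z \<in> A. f z = f x}" if "x \<in> A" for x
    using that by auto
  then have "A // kernel_on A f = (\<lambda>y. {x \<in> A. f x = y}) ` f ` A"
    by (force simp: quotient_def)
  moreover have "inj_on (\<lambda>y. {x \<in> A. f x = y}) (f ` A)"
    by (auto simp: inj_on_def)
  ultimately show ?thesis
    by (simp add: bij_betw_def)
qed

lemma card_quotient_kernel_on: "card (A // kernel_on A f) = card (f ` A)"
  using bij_betw_same_card[OF bij_betw_quotient_kernel_on] by metis

section \<open>Counting surjections\<close>

definition surjections :: "'a set \<Rightarrow> 'b set \<Rightarrow> ('a \<Rightarrow> 'b) set" where
  "surjections A B = {f \<in> A \<rightarrow>\<^sub>E B. f ` A = B}"

lemma finite_surjections: "finite A \<Longrightarrow> finite B \<Longrightarrow> finite (surjections A B)"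
  by (simp add: surjections_def finite_PiE)

lemma funcset_eq_Union_surjections: "A \<rightarrow>\<^sub>E S = (\<Union>T\<in>Pow S. surjections A T)"
  by (rule set_eqI) (auto simp: surjections_def)

text \<open>Every function into \<open>S\<close> is a surjection onto exactly one subset of
  \<open>S\<close>, its own image.\<close>

lemma card_funcset_eq_sum_surjections:
  assumes "finite A" and "finite S"
  shows "card S ^ card A = (\<Sum>T\<in>Pow S. card (surjections A T))"
proof -
  have "card (\<Union>T\<in>Pow S. surjections A T) = (\<Sum>T\<in>Pow S. card (surjections A T))"
  proof (rule card_UN_disjoint)
    show "finite (Pow S)"
      using assms by simp
    show "\<forall>T\<in>Pow S. finite (surjections A T)"
      using assms finite_subset[of _ S] by (auto intro: finite_surjections)
    show "\<forall>T\<in>Pow S. \<forall>T'\<in>Pow S. T \<noteq> T' \<longrightarrow> surjections A T \<inter> surjections A T' = {}"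
      by (auto simp: surjections_def)
  qed
  then show ?thesis
    by (metis funcset_eq_Union_surjections card_funcsetE assms(1))
qed

text \<open>Moebius inversion over the subsets of \<open>B\<close> turns the preceding count around;
  the subsets are then grouped by their size \<open>j\<close>.\<close>

lemma card_surjections:
  assumes "finite A" and "finite B"
  shows "real (card (surjections A B)) =
    (\<Sum>j=0..card B. (-1) ^ (card B - j) * real (card B choose j) * real j ^ card A)"
proof -
  have total: "real (card S ^ card A) = (\<Sum>T\<in>Pow S. real (card (surjections A T)))"
    if "finite S" for S :: "'b set"
    by (metis card_funcset_eq_sum_surjections[OF assms(1) that] of_nat_sum)
  have "real (card (surjections A B)) =
    (\<Sum>T\<in>Pow B. (-1) ^ (card B - card T) * real (card T ^ card A))"
    by (rule inclusion_exclusion_mobius[where f = "\<lambda>T. real (card (surjections A T))",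
          OF total assms(2)])
  also have "\<dots> = (\<Sum>j=0..card B. \<Sum>T\<in>{T \<in> Pow B. card T = j}.
      (-1) ^ (card B - card T) * real (card T ^ card A))"
    using assms(2) by (intro sum.group[symmetric]) (auto intro: card_mono)
  also have "\<dots> = (\<Sum>j=0..card B. (-1) ^ (card B - j) * real (card B choose j) * real j ^ card A)"
  proof (rule sum.cong[OF refl])
    fix j
    have "(\<Sum>T\<in>{T \<in> Pow B. card T = j}. (-1) ^ (card B - card T) * real (card T ^ card A)) =
        (\<Sum>T\<in>{T \<in> Pow B. card T = j}. (-1) ^ (card B - j) * real j ^ card A)"
      by (rule sum.cong) auto
    then show "(\<Sum>T\<in>{T \<in> Pow B. card T = j}. (-1) ^ (card B - card T) * real (card T ^ card A)) =
        (-1) ^ (card B - j) * real (card B choose j) * real j ^ card A"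
      using n_subsets[OF assms(2), of j] by simp
  qed
  finally show ?thesis .
qed

text \<open>One labelling \<open>f0\<close> of the classes of \<open>R\<close> by \<open>B\<close>
  is fixed; every surjection with kernel \<open>R\<close> is \<open>f0\<close> followed by a unique
  permutation of \<open>B\<close>.\<close>

lemma card_surjections_with_kernel:
  assumes "finite A" and "finite B" and "equiv A R" and "card (A // R) = card B"
  shows "card {f \<in> surjections A B. kernel_on A f = R} = fact (card B)"
proof -
  have "finite (A // R)"
    using assms(1,3) by (simp add: equiv_type finite_quotient)
  then obtain h where h: "bij_betw h (A // R) B"
    using assms(2,4) finite_same_card_bij by blast
  define f0 where "f0 = (\<lambda>x\<in>A. h (R `` {x}))"
  have f0_img: "f0 ` A = B"
    using h by (auto simp: f0_def bij_betw_def quotient_def)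
  have f0_eq: "f0 x = f0 y \<longleftrightarrow> (x, y) \<in> R" if "x \<in> A" "y \<in> A" for x y
    using that h eq_equiv_class_iff[OF assms(3)]
    by (auto simp: f0_def bij_betw_def quotientI inj_on_eq_iff)
  have "bij_betw (\<lambda>p. \<lambda>x\<in>A. p (f0 x)) {p. p permutes B} {f \<in> surjections A B. kernel_on A f = R}"
    unfolding bij_betw_def
  proof (intro conjI equalityI subsetI)
    show "inj_on (\<lambda>p. \<lambda>x\<in>A. p (f0 x)) {p. p permutes B}"
    proof (rule inj_onI)
      fix p q
      assume p: "p \<in> {p. p permutes B}" and q: "q \<in> {p. p permutes B}"
        and eq: "(\<lambda>x\<in>A. p (f0 x)) = (\<lambda>x\<in>A. q (f0 x))"
      have "p y = q y" for y
      proof (cases "y \<in> B")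
        case True
        then obtain x where "x \<in> A" "y = f0 x"
          using f0_img by blast
        then show ?thesis
          using fun_cong[OF eq, of x] by simp
      next
        case False
        then show ?thesis
          using p q by (simp add: permutes_not_in)
      qed
      then show "p = q" ..
    qed
  next
    fix f
    assume "f \<in> (\<lambda>p. \<lambda>x\<in>A. p (f0 x)) ` {p. p permutes B}"
    then obtain p where p: "p permutes B" and f: "f = (\<lambda>x\<in>A. p (f0 x))"
      by auto
    have img: "f ` A = B"
      using f f0_img permutes_image[OF p] by (metis image_image image_restrict_eq)
    have "kernel_on A f = R"
      by (rule equiv_eq_kernel_on[OF assms(3), symmetric])
        (simp add: f f0_eq inj_eq[OF permutes_inj[OF p]])
    then show "f \<in> {f \<in> surjections A B. kernel_on A f = R}"
      using img f by (auto simp: surjections_def)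
  next
    fix f
    assume "f \<in> {f \<in> surjections A B. kernel_on A f = R}"
    then have f: "f \<in> A \<rightarrow>\<^sub>E B" "f ` A = B" and ker: "kernel_on A f = R"
      by (auto simp: surjections_def)
    \<comment> \<open>The relabelling is read off at any \<open>f0\<close>-preimage, which is
      harmless because \<open>f\<close> and \<open>f0\<close> have the same kernel. Outside
      \<open>B\<close> it is the identity, as \<open>permutes\<close> demands; being onto the finite
      set \<open>B\<close>, it is injective there.\<close>
    define p where "p y = (if y \<in> B then f (inv_into A f0 y) else y)" for y
    have p_f0: "p (f0 x) = f x" if "x \<in> A" for x
    proof -
      have fx: "f0 x \<in> f0 ` A"
        using that by simp
      have "(inv_into A f0 (f0 x), x) \<in> R"
        using f0_eq[of "inv_into A f0 (f0 x)" x] inv_into_into[OF fx] f_inv_into_f[OF fx] that by auto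
      then show ?thesis
        using ker fx f0_img by (auto simp: p_def)
    qed
    have "p ` B = B"
      using p_f0 f0_img f(2) by (metis (no_types, lifting) image_cong image_image)
    then have "p permutes B"
      using assms(2) by (intro bij_imp_permutes) (auto simp: bij_betw_def p_def finite_surj_inj)
    moreover have "f = (\<lambda>x\<in>A. p (f0 x))"
      using p_f0 PiE_arb[OF f(1)] by (intro ext) (simp add: restrict_def)
    ultimately show "f \<in> (\<lambda>p. \<lambda>x\<in>A. p (f0 x)) ` {p. p permutes B}"
      by blast
  qed
  then have "card {f \<in> surjections A B. kernel_on A f = R} = card {p. p permutes B}"
    by (simp add: bij_betw_same_card)
  then show ?thesis
    using card_permutations[OF refl assms(2)] by simp
qed

section \<open>Ranks of least representatives\<close>

lemma card_atMost_less_iff: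
  fixes D :: "'a :: linorder set"
  assumes "finite D" and "x \<in> D" and "y \<in> D"
  shows "card {z \<in> D. z \<le> x} < card {z \<in> D. z \<le> y} \<longleftrightarrow> x < y"
proof -
  have less: "card {z \<in> D. z \<le> a} < card {z \<in> D. z \<le> b}" if "a < b" "b \<in> D" for a b
  proof -
    have "b \<notin> {z \<in> D. z \<le> a}" and "b \<in> {z \<in> D. z \<le> b}"
      using that by auto
    then show ?thesis
      using that(1) assms(1) by (intro psubset_card_mono) (auto intro: order.trans)
  qed
  show ?thesis
    using less[of x y] less[of y x] assms(2,3) by (cases x y rule: linorder_cases) auto
qed

lemma card_atMost_eq_iff:
  fixes D :: "'a :: linorder set"
  assumes "finite D" and "x \<in> D" and "y \<in> D"
  shows "card {z \<in> D. z \<le> x} = card {z \<in> D. z \<le> y} \<longleftrightarrow> x = y"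
  using card_atMost_less_iff[OF assms] card_atMost_less_iff[OF assms(1,3,2)]
  by (cases x y rule: linorder_cases) auto

text \<open>The ranks are distinct and lie in a set of the same finite size, so they fill
  it.\<close>

lemma image_card_atMost:
  fixes D :: "'a :: linorder set"
  assumes "finite D"
  shows "(\<lambda>x. card {z \<in> D. z \<le> x}) ` D = {1..card D}"
proof (rule card_subset_eq)
  show "(\<lambda>x. card {z \<in> D. z \<le> x}) ` D \<subseteq> {1..card D}"
  proof clarify
    fix x assume "x \<in> D"
    then have "{z \<in> D. z \<le> x} \<noteq> {}"
      by auto
    then have "0 < card {z \<in> D. z \<le> x}"
      using assms by (simp add: card_gt_0_iff del: Collect_empty_eq)
    then show "card {z \<in> D. z \<le> x} \<in> {1..card D}"
      using assms card_mono[of D "{z \<in> D. z \<le> x}"] by auto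
  qed
  have "inj_on (\<lambda>x. card {z \<in> D. z \<le> x}) D"
    using card_atMost_eq_iff[OF assms] by (auto simp: inj_on_def)
  then show "card ((\<lambda>x. card {z \<in> D. z \<le> x}) ` D) = card {1..card D}"
    by (simp add: card_image)
qed simp

section \<open>Least representatives of kernel classes and the resulting numbering\<close>

definition least_rep :: "'a :: wellorder set \<Rightarrow> ('a \<Rightarrow> 'b) \<Rightarrow> 'a \<Rightarrow> 'a" where
  "least_rep A f x = (LEAST y. y \<in> A \<and> f y = f x)"

text \<open>The position of the class of \<open>x\<close> when classes are ordered by their least
  elements. Counting with \<le> makes positions start at 1, matching \<open>{1..n}\<close>.\<close>

definition class_rank :: "'a :: wellorder set \<Rightarrow> ('a \<Rightarrow> 'b) \<Rightarrow> 'a \<Rightarrow> nat" where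
  "class_rank A f x = card {y \<in> least_rep A f ` A. y \<le> least_rep A f x}"

lemma
  assumes "x \<in> A"
  shows least_rep_in: "least_rep A f x \<in> A"
    and least_rep_map: "f (least_rep A f x) = f x"
  using LeastI[of "\<lambda>y. y \<in> A \<and> f y = f x" x] assms by (simp_all add: least_rep_def)

lemma least_rep_eq_iff:
  assumes "x \<in> A" and "y \<in> A"
  shows "least_rep A f x = least_rep A f y \<longleftrightarrow> f x = f y"
proof
  assume "least_rep A f x = least_rep A f y"
  then show "f x = f y"
    using least_rep_map[OF assms(1), of f] least_rep_map[OF assms(2), of f] by simp
qed (simp add: least_rep_def)

lemma least_rep_cong:
  assumes "kernel_on A f = kernel_on A g" and "x \<in> A"
  shows "least_rep A f x = least_rep A g x"
proof -
  have "(y \<in> A \<and> f y = f x) = (y \<in> A \<and> g y = g x)" for y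
    using assms by (auto simp: kernel_on_eq_iff)
  then show ?thesis
    by (simp add: least_rep_def)
qed

text \<open>Least representatives depend on the partition only, not on the values naming its
  classes. This is why a kernel forces the numbering of a table.\<close>

lemma class_rank_cong:
  assumes "kernel_on A f = kernel_on A g" and "x \<in> A"
  shows "class_rank A f x = class_rank A g x"
proof -
  have "least_rep A f ` A = least_rep A g ` A"
    using least_rep_cong[OF assms(1)] by (simp cong: image_cong)
  then show ?thesis
    using least_rep_cong[OF assms] by (simp add: class_rank_def)
qed

lemma least_rep_image_bij: "bij_betw f (least_rep A f ` A) (f ` A)"
  using least_rep_map[of _ A f] by (force simp: bij_betw_def inj_on_def least_rep_eq_iff image_image)

lemma
  assumes "finite (f ` A)"
  shows finite_least_reps: "finite (least_rep A f ` A)"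
    and card_least_reps: "card (least_rep A f ` A) = card (f ` A)"
  using bij_betw_finite[OF least_rep_image_bij, of A f] bij_betw_same_card[OF least_rep_image_bij, of A f]
    assms by auto

lemma class_rank_less_iff:
  assumes "finite (f ` A)" and "x \<in> A" and "y \<in> A"
  shows "class_rank A f x < class_rank A f y \<longleftrightarrow> least_rep A f x < least_rep A f y"
  using card_atMost_less_iff[OF finite_least_reps[OF assms(1)]] assms(2,3)
  by (simp add: class_rank_def)

lemma class_rank_eq_iff:
  assumes "finite (f ` A)" and "x \<in> A" and "y \<in> A"
  shows "class_rank A f x = class_rank A f y \<longleftrightarrow> f x = f y"
  using card_atMost_eq_iff[OF finite_least_reps[OF assms(1)]] assms(2,3)
  by (simp add: class_rank_def least_rep_eq_iff)

lemma class_rank_image: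
  assumes "finite (f ` A)"
  shows "class_rank A f ` A = {1..card (f ` A)}"
  using image_card_atMost[OF finite_least_reps[OF assms]] card_least_reps[OF assms]
  by (simp add: class_rank_def image_image)

section \<open>Words and their products\<close>

lemma free_semigroup_iff [simp]: "u \<in> free_semigroup k \<longleftrightarrow> u \<noteq> [] \<and> set u \<subseteq> {1..k}"
  by (auto simp: free_semigroup_def)

lemma word_product_single [simp]: "word_product m [x] = x"
  by (simp add: word_product_def)

lemma word_product_snoc: "u \<noteq> [] \<Longrightarrow> word_product m (u @ [x]) = m (word_product m u) x"
  by (simp add: word_product_def)

lemma word_product_closed:
  assumes "\<And>x y. x \<in> A \<Longrightarrow> y \<in> A \<Longrightarrow> m x y \<in> A" and "u \<noteq> []" and "set u \<subseteq> A"
  shows "word_product m u \<in> A"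
  using assms(2,3)
proof (induction u rule: rev_nonempty_induct)
  case (snoc x u)
  then show ?case
    using assms(1) by (simp add: word_product_snoc)
qed simp

text \<open>The product is a left fold, so the last letter of \<open>v\<close> can be peeled off and
  one use of associativity suffices. The laws are asked for on a carrier \<open>A\<close> only,
  since tables satisfy them on \<open>{1..n}\<close>.\<close>

lemma word_product_append:
  assumes closed: "\<And>x y. x \<in> A \<Longrightarrow> y \<in> A \<Longrightarrow> m x y \<in> A"
    and assoc: "\<And>x y z. x \<in> A \<Longrightarrow> y \<in> A \<Longrightarrow> z \<in> A \<Longrightarrow> m (m x y) z = m x (m y z)"
    and u: "u \<noteq> []" "set u \<subseteq> A" and v: "v \<noteq> []" "set v \<subseteq> A"
  shows "word_product m (u @ v) = m (word_product m u) (word_product m v)"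
  using v
proof (induction v rule: rev_nonempty_induct)
  case (single x)
  then show ?case
    using u by (simp add: word_product_snoc)
next
  case (snoc x v)
  then have "word_product m ((u @ v) @ [x]) = m (m (word_product m u) (word_product m v)) x"
    using u by (subst word_product_snoc) auto
  also have "\<dots> = m (word_product m u) (m (word_product m v) x)"
    using snoc u closed by (intro assoc word_product_closed[where A = A]) auto
  finally show ?case
    using snoc by (simp add: word_product_snoc)
qed

lemma subsemigroup_generated_eq:
  assumes closed: "\<And>x y. x \<in> A \<Longrightarrow> y \<in> A \<Longrightarrow> m x y \<in> A"
    and assoc: "\<And>x y z. x \<in> A \<Longrightarrow> y \<in> A \<Longrightarrow> z \<in> A \<Longrightarrow> m (m x y) z = m x (m y z)"
    and B: "B \<subseteq> A"
  shows "subsemigroup_generated m B = word_product m ` {u. u \<noteq> [] \<and> set u \<subseteq> B}"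
proof (intro equalityI subsetI)
  fix x assume "x \<in> subsemigroup_generated m B"
  then show "x \<in> word_product m ` {u. u \<noteq> [] \<and> set u \<subseteq> B}"
  proof induction
    case (incl a)
    then show ?case
      by (intro image_eqI[of _ _ "[a]"]) auto
  next
    case (mult x y)
    then obtain u v where "u \<noteq> []" "set u \<subseteq> B" "x = word_product m u"
      and "v \<noteq> []" "set v \<subseteq> B" "y = word_product m v"
      by auto
    then show ?case
      using B by (intro image_eqI[of _ _ "u @ v"])
        (auto intro!: word_product_append[where A = A, symmetric] closed assoc)
  qed
next
  fix x assume "x \<in> word_product m ` {u. u \<noteq> [] \<and> set u \<subseteq> B}"
  then obtain u where "u \<noteq> []" "set u \<subseteq> B" "x = word_product m u"
    by auto
  then show "x \<in> subsemigroup_generated m B"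
    by (auto intro!: word_product_closed
        intro: subsemigroup_generated.incl subsemigroup_generated.mult)
qed

section \<open>Cayley tables and the evaluation of words in them\<close>

lemma semigroup_tablesD:
  assumes "m \<in> semigroup_tables n"
  shows semigroup_tables_closed: "x \<in> {1..n} \<Longrightarrow> y \<in> {1..n} \<Longrightarrow> m x y \<in> {1..n}"
    and semigroup_tables_assoc: "x \<in> {1..n} \<Longrightarrow> y \<in> {1..n} \<Longrightarrow> z \<in> {1..n} \<Longrightarrow> m (m x y) z = m x (m y z)"
    and semigroup_tables_ext: "x \<notin> {1..n} \<Longrightarrow> m x = undefined"
    and semigroup_tables_ext2: "x \<in> {1..n} \<Longrightarrow> y \<notin> {1..n} \<Longrightarrow> m x y = undefined"
proof -
  have m: "m \<in> {1..n} \<rightarrow>\<^sub>E {1..n} \<rightarrow>\<^sub>E {1..n}"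
    and assoc: "\<forall>x\<in>{1..n}. \<forall>y\<in>{1..n}. \<forall>z\<in>{1..n}. m (m x y) z = m x (m y z)"
    using assms unfolding semigroup_tables_def by blast+
  show "x \<in> {1..n} \<Longrightarrow> y \<in> {1..n} \<Longrightarrow> m x y \<in> {1..n}"
    using m by (blast dest: PiE_mem)
  show "x \<in> {1..n} \<Longrightarrow> y \<in> {1..n} \<Longrightarrow> z \<in> {1..n} \<Longrightarrow> m (m x y) z = m x (m y z)"
    using assoc by blast
  show "x \<notin> {1..n} \<Longrightarrow> m x = undefined"
    using m by (rule PiE_arb)
  show "x \<in> {1..n} \<Longrightarrow> y \<notin> {1..n} \<Longrightarrow> m x y = undefined"
    using m by (blast dest: PiE_mem PiE_arb)
qed

text \<open>Generation by \<open>{1..k}\<close> is recast as surjectivity of word evaluation, which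
  lets elements be replaced by words.\<close>

lemma C_tablesD:
  assumes "m \<in> C_tables n k"
  shows C_tables_semigroup: "m \<in> semigroup_tables n"
    and C_tables_le: "{1..k} \<subseteq> {1..n}"
    and C_tables_image: "word_product m ` free_semigroup k = {1..n}"
proof -
  show m: "m \<in> semigroup_tables n"
    using assms by (simp add: C_tables_def)
  have gen: "subsemigroup_generated m {1..k} = {1..n}"
    using assms by (simp add: C_tables_def)
  show sub: "{1..k} \<subseteq> {1..n}"
    using gen subsemigroup_generated.incl[of _ "{1..k}" m] by blast
  have "subsemigroup_generated m {1..k} = word_product m ` {u. u \<noteq> [] \<and> set u \<subseteq> {1..k}}"
    using semigroup_tables_closed[OF m] semigroup_tables_assoc[OF m] sub
    by (rule subsemigroup_generated_eq)
  also have "{u. u \<noteq> [] \<and> set u \<subseteq> {1..k}} = free_semigroup k"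
    by (simp add: set_eq_iff del: atLeastAtMost_iff)
  finally show "word_product m ` free_semigroup k = {1..n}"
    using gen by simp
qed

lemma C_tables_word_product_append:
  assumes "m \<in> C_tables n k" and "u \<in> free_semigroup k" and "v \<in> free_semigroup k"
  shows "word_product m (u @ v) = m (word_product m u) (word_product m v)"
  using assms(2,3) C_tables_le[OF assms(1)] semigroup_tables_closed[OF C_tables_semigroup[OF assms(1)]]
    semigroup_tables_assoc[OF C_tables_semigroup[OF assms(1)]]
  by (intro word_product_append[where A = "{1..n}"]) auto

section \<open>Least decompositions as least representatives of the evaluation kernel\<close>

lemma dec_word_product:
  "dec m k (word_product m u) = least_rep (free_semigroup k) (word_product m) u"
  by (simp add: dec_def least_rep_def)

lemma single_less_iff: "[i] < v \<longleftrightarrow> length v > 1 \<or> (\<exists>j. v = [j] \<and> i < j)" for i :: nat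
  by (cases v) (auto simp: Cons_less_Cons)

text \<open>One-letter words precede all longer ones in shortlex, and the only one-letter word with
  product \<open>i\<close> is \<open>[i]\<close>.\<close>

lemma dec_generator:
  assumes "i \<in> {1..k}"
  shows "dec m k i = [i]"
  unfolding dec_def
proof (rule Least_equality)
  fix v
  assume v: "v \<noteq> [] \<and> set v \<subseteq> {1..k} \<and> word_product m v = i"
  show "[i] \<le> v"
  proof (cases "length v > 1")
    case False
    then obtain j where "v = [j]"
      using v by (cases v) auto
    then show ?thesis
      using v by simp
  qed (simp add: single_less_iff order_less_imp_le)
qed (use assms in auto)

text \<open>The definition of \<open>T_tables\<close> orders decompositions only beyond
  \<open>k\<close>. Generators decompose as themselves, which extends the ordering to all of
  \<open>{1..n}\<close>.\<close>

lemma T_tables_dec_mono: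
  assumes m: "m \<in> T_tables n k" and "i \<in> {1..n}" and "j \<in> {1..n}" and "i < j"
  shows "dec m k i < dec m k j"
proof -
  have C: "m \<in> C_tables n k" and asc: "\<And>i. k < i \<Longrightarrow> i < n \<Longrightarrow> dec m k i < dec m k (Suc i)"
    using m by (auto simp: T_tables_def)
  have step: "dec m k i < dec m k (Suc i)" if i: "i \<in> {1..n}" "Suc i \<in> {1..n}" for i
  proof (cases "k < i")
    case True
    then show ?thesis
      using asc i by simp
  next
    case False
    obtain v where v: "v \<in> free_semigroup k" "word_product m v = Suc i"
      using C_tables_image[OF C] i by (metis imageE)
    let ?d = "dec m k (Suc i)"
    have d: "?d \<in> free_semigroup k" "word_product m ?d = Suc i"
      using least_rep_in[OF v(1), of "word_product m"] least_rep_map[OF v(1), of "word_product m"] v(2)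
        dec_word_product[of m k v] by auto
    \<comment> \<open>A one-letter decomposition of \<open>Suc i\<close> must be
      \<open>[Suc i]\<close>, so \<open>[i]\<close> is smaller whether or not \<open>Suc i\<close>
      is still a generator.\<close>
    have "length ?d > 1 \<or> ?d = [Suc i]"
      using d by (cases ?d; cases "tl ?d") auto
    then have "[i] < ?d"
      by (auto simp: single_less_iff)
    then show ?thesis
      using dec_generator[of i k m] i False by simp
  qed
  from \<open>i < j\<close> show ?thesis
    using assms(2,3)
  proof (induction j)
    case (Suc j)
    show ?case
    proof (cases "i = j")
      case False
      then show ?thesis
        using Suc step[of j] by (auto intro: order.strict_trans)
    qed (use Suc step in auto)
  qed simp
qed

text \<open>The least representatives are the values of \<open>dec m k\<close> on
  \<open>{1..n}\<close>, where it is strictly increasing. Those up to the decomposition of an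
  element \<open>w\<close> therefore belong to \<open>1, ..., w\<close>, and there are
  \<open>w\<close> of them.\<close>

lemma T_tables_class_rank:
  assumes m: "m \<in> T_tables n k" and u: "u \<in> free_semigroup k"
  shows "class_rank (free_semigroup k) (word_product m) u = word_product m u"
proof -
  let ?A = "free_semigroup k" and ?p = "word_product m"
  have C: "m \<in> C_tables n k"
    using m by (simp add: T_tables_def)
  have in_n: "?p u \<in> {1..n}"
    using C_tables_image[OF C] u by blast
  have mono: "strict_mono_on {1..n} (dec m k)"
    using T_tables_dec_mono[OF m] by (simp add: strict_mono_on_def)
  have "least_rep ?A ?p ` ?A = dec m k ` {1..n}"
    unfolding C_tables_image[OF C, symmetric] by (simp add: dec_word_product image_image)
  then have "{y \<in> least_rep ?A ?p ` ?A. y \<le> least_rep ?A ?p u} = dec m k ` {1..?p u}"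
    using in_n strict_mono_on_less_eq[OF mono] by (auto simp flip: dec_word_product)
  moreover have "inj_on (dec m k) {1..?p u}"
    using in_n strict_mono_on_imp_inj_on[OF mono] by (auto intro: inj_on_subset)
  ultimately show ?thesis
    by (simp add: class_rank_def card_image)
qed

text \<open>The numbering of the elements in a table of \<open>T_tables n k\<close> is the shortlex rank of their
  decompositions, so it can be recovered from the kernel alone.\<close>

lemma T_tables_eqI:
  assumes m: "m \<in> T_tables n k" and m': "m' \<in> T_tables n k"
    and ker: "kernel_on (free_semigroup k) (word_product m) = kernel_on (free_semigroup k) (word_product m')"
  shows "m = m'"
proof -
  have C: "m \<in> C_tables n k" and C': "m' \<in> C_tables n k"
    using m m' by (simp_all add: T_tables_def)
  \<comment> \<open>Both products equal the rank of \<open>u\<close> in the common kernel.\<close>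
  have eq: "word_product m u = word_product m' u" if "u \<in> free_semigroup k" for u
    using class_rank_cong[OF ker that] T_tables_class_rank[OF m that] T_tables_class_rank[OF m' that]
    by simp
  have eq_in: "m x y = m' x y" if xy: "x \<in> {1..n}" "y \<in> {1..n}" for x y
  proof -
    obtain u v where u: "u \<in> free_semigroup k" "x = word_product m u"
      and v: "v \<in> free_semigroup k" "y = word_product m v"
      using xy C_tables_image[OF C] by (metis imageE)
    have uv: "u @ v \<in> free_semigroup k"
      using u v by auto
    show ?thesis
      using C_tables_word_product_append[OF C u(1) v(1)] C_tables_word_product_append[OF C' u(1) v(1)]
        eq[OF u(1)] eq[OF v(1)] eq[OF uv] u(2) v(2) by simp
  qed
  \<comment> \<open>Off \<open>{1..n}\<close> both tables are \<open>undefined\<close>, so agreement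
    of entries gives equality of functions.\<close>
  note S = C_tables_semigroup[OF C] C_tables_semigroup[OF C']
  show ?thesis
  proof (intro ext)
    fix x y
    show "m x y = m' x y"
      using eq_in[of x y] S[THEN semigroup_tables_ext, of x] S[THEN semigroup_tables_ext2, of x y]
      by (cases "x \<in> {1..n}"; cases "y \<in> {1..n}") auto
  qed
qed

section \<open>Congruences on free semigroups\<close>

text \<open>The factors are exchanged one at a time, passing through \<open>y @ x'\<close>.\<close>

lemma congruence_on_append:
  assumes "congruence_on (free_semigroup r) (@) \<rho>" and "(x, y) \<in> \<rho>" and "(x', y') \<in> \<rho>"
  shows "(x @ x', y @ y') \<in> \<rho>"
proof -
  have eq: "equiv (free_semigroup r) \<rho>"
    and comp: "\<And>x y z. (x, y) \<in> \<rho> \<Longrightarrow> z \<in> free_semigroup r \<Longrightarrow> (z @ x, z @ y) \<in> \<rho> \<and> (x @ z, y @ z) \<in> \<rho>"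
    using assms(1) unfolding congruence_on_def by blast+
  have in_S: "x' \<in> free_semigroup r" "y \<in> free_semigroup r"
    using equiv_type[OF eq] assms(2,3) by blast+
  have "(x @ x', y @ x') \<in> \<rho>" and "(y @ x', y @ y') \<in> \<rho>"
    using comp assms(2,3) in_S by blast+
  then show ?thesis
    using eq by (meson equivE transE)
qed

lemma congruence_on_map:
  assumes cong: "congruence_on (free_semigroup r) (@) \<rho>"
    and letters: "\<And>i. i \<in> {1..r} \<Longrightarrow> ([h i], [i]) \<in> \<rho>"
    and "w \<noteq> []" and "set w \<subseteq> {1..r}"
  shows "(map h w, w) \<in> \<rho>"
  using assms(3,4)
proof (induction w rule: rev_nonempty_induct)
  case (snoc i w)
  then show ?case
    using congruence_on_append[OF cong _ letters, of "map h w" w i] by simp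
qed (use letters in simp)

section \<open>The congruence given by a surjection of letters and a table\<close>

definition congruences_of_index :: "nat \<Rightarrow> nat \<Rightarrow> (nat list \<times> nat list) set set" where
  "congruences_of_index r n =
     {\<rho>. congruence_on (free_semigroup r) (@) \<rho> \<and> card (free_semigroup r // \<rho>) = n}"

definition letter_kernel :: "nat \<Rightarrow> (nat list \<times> nat list) set \<Rightarrow> (nat \<times> nat) set" where
  "letter_kernel r \<rho> = {(i, j) \<in> {1..r} \<times> {1..r}. ([i], [j]) \<in> \<rho>}"

text \<open>For \<open>m\<close> in \<open>C_tables n k\<close> and \<open>f\<close> onto
  \<open>{1..k}\<close>, this is the kernel of the homomorphism from the free semigroup to
  \<open>m\<close> that sends the letter \<open>i\<close> to \<open>f i\<close>.\<close>

definition evaluation_kernel ::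
    "nat \<Rightarrow> (nat \<Rightarrow> nat) \<Rightarrow> (nat \<Rightarrow> nat \<Rightarrow> nat) \<Rightarrow> (nat list \<times> nat list) set" where
  "evaluation_kernel r f m = kernel_on (free_semigroup r) (\<lambda>u. word_product m (map f u))"

lemma equiv_letter_kernel:
  assumes "congruence_on (free_semigroup r) (@) \<rho>"
  shows "equiv {1..r} (letter_kernel r \<rho>)"
proof -
  have "equiv (free_semigroup r) \<rho>"
    using assms by (simp add: congruence_on_def)
  then have refl: "\<And>w. w \<in> free_semigroup r \<Longrightarrow> (w, w) \<in> \<rho>"
    and sym: "\<And>u v. (u, v) \<in> \<rho> \<Longrightarrow> (v, u) \<in> \<rho>"
    and trans: "\<And>u v w. (u, v) \<in> \<rho> \<Longrightarrow> (v, w) \<in> \<rho> \<Longrightarrow> (u, w) \<in> \<rho>"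
    by (auto simp: equiv_def refl_on_def dest: symD transD)
  show ?thesis
  proof (rule equivI)
    show "refl_on {1..r} (letter_kernel r \<rho>)"
      using refl by (auto simp: refl_on_def letter_kernel_def)
    show "sym (letter_kernel r \<rho>)"
      using sym by (auto simp: sym_def letter_kernel_def)
    show "trans (letter_kernel r \<rho>)"
      using trans by (auto simp: trans_def letter_kernel_def)
  qed (auto simp: letter_kernel_def)
qed

lemma
  assumes "f \<in> surjections {1..r} {1..k}"
  shows surjections_map_in: "u \<in> free_semigroup r \<Longrightarrow> map f u \<in> free_semigroup k"
    and surjections_map_image: "map f ` free_semigroup r = free_semigroup k"
proof -
  have img: "f ` {1..r} = {1..k}"
    using assms by (simp add: surjections_def)
  then have "map f ` lists {1..r} = lists {1..k}"
    by (simp flip: lists_image)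
  then show image: "map f ` free_semigroup r = free_semigroup k"
    by (auto simp: free_semigroup_def)
  show "u \<in> free_semigroup r \<Longrightarrow> map f u \<in> free_semigroup k"
    using image by blast
qed

text \<open>Evaluation after \<open>map f\<close> is a homomorphism, onto \<open>{1..n}\<close>
  because \<open>f\<close> reaches all generators, so its kernel is a congruence with
  \<open>n\<close> classes. On the letter \<open>i\<close> it takes the value
  \<open>f i\<close>.\<close>

lemma evaluation_kernel_in:
  assumes f: "f \<in> surjections {1..r} {1..k}" and C: "m \<in> C_tables n k"
  shows "evaluation_kernel r f m \<in> congruences_of_index r n"
    and "letter_kernel r (evaluation_kernel r f m) = kernel_on {1..r} f"
proof -
  note in_k = surjections_map_in[OF f]
  have append: "word_product m (map f (u @ v)) = m (word_product m (map f u)) (word_product m (map f v))"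
    if "u \<in> free_semigroup r" "v \<in> free_semigroup r" for u v
    using C_tables_word_product_append[OF C in_k[OF that(1)] in_k[OF that(2)]] by simp
  have "(\<lambda>u. word_product m (map f u)) ` free_semigroup r = word_product m ` free_semigroup k"
    unfolding surjections_map_image[OF f, symmetric] by (simp add: image_image)
  also have "\<dots> = {1..n}"
    by (rule C_tables_image[OF C])
  finally have "card (free_semigroup r // evaluation_kernel r f m) = n"
    by (simp add: evaluation_kernel_def card_quotient_kernel_on)
  moreover have "congruence_on (free_semigroup r) (@) (evaluation_kernel r f m)"
    unfolding congruence_on_def
  proof (intro conjI)
    show "equiv (free_semigroup r) (evaluation_kernel r f m)"
      by (simp add: evaluation_kernel_def equiv_kernel_on)
    have "(z @ x, z @ y) \<in> evaluation_kernel r f m \<and> (x @ z, y @ z) \<in> evaluation_kernel r f m"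
      if xy: "(x, y) \<in> evaluation_kernel r f m" and z: "z \<in> free_semigroup r" for x y z
    proof -
      have "x \<in> free_semigroup r" "y \<in> free_semigroup r"
        and "word_product m (map f x) = word_product m (map f y)"
        using xy by (simp_all add: evaluation_kernel_def del: free_semigroup_iff)
      then show ?thesis
        using append[of x z] append[of y z] append[of z x] append[of z y] z
        by (simp add: evaluation_kernel_def)
    qed
    then show "\<forall>(x, y)\<in>evaluation_kernel r f m. \<forall>z\<in>free_semigroup r.
        (z @ x, z @ y) \<in> evaluation_kernel r f m \<and> (x @ z, y @ z) \<in> evaluation_kernel r f m"
      by blast
  qed
  ultimately show "evaluation_kernel r f m \<in> congruences_of_index r n"
    by (simp add: congruences_of_index_def)
  show "letter_kernel r (evaluation_kernel r f m) = kernel_on {1..r} f"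
    by (auto simp: letter_kernel_def evaluation_kernel_def)
qed

text \<open>Numbering the classes by shortlex rank turns the quotient into an ascendingly generated table.\<close>

lemma T_tables_evaluation_kernel_exists:
  assumes f: "f \<in> surjections {1..r} {1..k}" and n: "n \<ge> 1"
    and \<rho>: "\<rho> \<in> congruences_of_index r n" and letters: "letter_kernel r \<rho> = kernel_on {1..r} f"
  obtains m where "m \<in> T_tables n k" and "evaluation_kernel r f m = \<rho>"
proof -
  have cong: "congruence_on (free_semigroup r) (@) \<rho>"
    and index: "card (free_semigroup r // \<rho>) = n"
    using \<rho> by (simp_all add: congruences_of_index_def)
  have equiv: "equiv (free_semigroup r) \<rho>"
    using cong by (simp add: congruence_on_def)
  have letter_iff: "([i], [j]) \<in> \<rho> \<longleftrightarrow> f i = f j" if "i \<in> {1..r}" "j \<in> {1..r}" for i j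
  proof -
    have "(i, j) \<in> letter_kernel r \<rho> \<longleftrightarrow> (i, j) \<in> kernel_on {1..r} f"
      by (simp only: letters)
    then show ?thesis
      using that by (simp add: letter_kernel_def)
  qed
  have img: "f ` {1..r} = {1..k}"
    using f by (simp add: surjections_def)
  \<comment> \<open>A section of \<open>f\<close>: each generator gets one letter, so words over
    \<open>{1..k}\<close> become words over the \<open>r\<close> letters.\<close>
  define g where "g = inv_into {1..r} f"
  have g_in: "g a \<in> {1..r}" and f_g: "f (g a) = a" if "a \<in> {1..k}" for a
    using that img inv_into_into[of a f "{1..r}"] f_inv_into_f[of a f "{1..r}"] by (simp_all add: g_def)
  define A where "A = free_semigroup k"
  \<comment> \<open>\<open>\<phi>\<close> sends a word over \<open>{1..k}\<close> to its
    \<rho>-class, and \<open>\<psi>\<close> replaces that class by its shortlex rank.\<close>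
  define \<phi> where "\<phi> u = \<rho> `` {map g u}" for u
  define \<psi> where "\<psi> = class_rank A \<phi>"
  have map_g: "map g u \<in> free_semigroup r" if "u \<in> A" for u
    using that g_in by (auto simp: A_def)
  have \<phi>_iff: "\<phi> u = \<phi> v \<longleftrightarrow> (map g u, map g v) \<in> \<rho>" if "u \<in> A" "v \<in> A" for u v
    using eq_equiv_class_iff[OF equiv map_g[OF that(1)] map_g[OF that(2)]] by (simp add: \<phi>_def)
  have f_in: "f i \<in> {1..k}" if "i \<in> {1..r}" for i
    using that img by blast
  \<comment> \<open>Going through \<open>f\<close> and back by \<open>g\<close> changes each letter
    to a congruent one. Hence \<open>\<phi>\<close> meets every class.\<close>
  have gf: "(map g (map f w), w) \<in> \<rho>" if "w \<in> free_semigroup r" for w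
    using congruence_on_map[OF cong, of "\<lambda>i. g (f i)" w] that letter_iff g_in f_in f_g
    by (simp add: o_def)
  have append_in: "u @ v \<in> A" if "u \<in> A" "v \<in> A" for u v
    using that by (simp add: A_def)
  have "\<phi> ` A = free_semigroup r // \<rho>"
  proof (intro equalityI subsetI)
    fix c assume "c \<in> \<phi> ` A"
    then show "c \<in> free_semigroup r // \<rho>"
      using map_g by (auto simp: \<phi>_def simp del: free_semigroup_iff intro: quotientI)
  next
    fix c assume "c \<in> free_semigroup r // \<rho>"
    then obtain w where w: "w \<in> free_semigroup r" "c = \<rho> `` {w}"
      by (auto elim: quotientE)
    then have "c = \<phi> (map f w)"
      using equiv_class_eq[OF equiv gf[OF w(1)]] by (simp add: \<phi>_def)
    then show "c \<in> \<phi> ` A"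
      using surjections_map_in[OF f w(1)] by (auto simp: A_def)
  qed
  then have card_\<phi>: "card (\<phi> ` A) = n"
    using index by simp
  \<comment> \<open>An infinite set has \<open>card\<close> 0, so \<open>n \<ge> 1\<close> forces
    finiteness.\<close>
  then have fin: "finite (\<phi> ` A)"
    using n by (metis card.infinite not_one_le_zero)
  have \<psi>_image: "\<psi> ` A = {1..n}"
    using class_rank_image[OF fin] card_\<phi> by (simp add: \<psi>_def)
  have \<psi>_iff: "\<psi> u = \<psi> v \<longleftrightarrow> (map g u, map g v) \<in> \<rho>" if "u \<in> A" "v \<in> A" for u v
    using class_rank_eq_iff[OF fin that] \<phi>_iff[OF that] by (simp add: \<psi>_def)

  \<comment> \<open>Ranks are multiplied by concatenating chosen words \<open>s a\<close>,
    \<open>s b\<close> with these ranks and taking the rank of the result.\<close>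
  define s where "s = inv_into A \<psi>"
  have s_in: "s a \<in> A" and \<psi>_s: "\<psi> (s a) = a" if "a \<in> {1..n}" for a
    using that inv_into_into[of a \<psi> A] f_inv_into_f[of a \<psi> A] \<psi>_image by (simp_all add: s_def)
  define m where "m = (\<lambda>a\<in>{1..n}. \<lambda>b\<in>{1..n}. \<psi> (s a @ s b))"
  \<comment> \<open>Since \<rho> is a congruence, the choice of words is immaterial and
    \<open>\<psi>\<close> is a homomorphism. Closure and associativity are then inherited from
    concatenation.\<close>
  have m_\<psi>: "m (\<psi> u) (\<psi> v) = \<psi> (u @ v)" if u: "u \<in> A" and v: "v \<in> A" for u v
  proof -
    have n_in: "\<psi> u \<in> {1..n}" "\<psi> v \<in> {1..n}"
      using u v \<psi>_image by blast+
    note su = s_in[OF n_in(1)] and sv = s_in[OF n_in(2)]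
    have "(map g (s (\<psi> u)), map g u) \<in> \<rho>" and "(map g (s (\<psi> v)), map g v) \<in> \<rho>"
      using \<psi>_s[OF n_in(1)] \<psi>_s[OF n_in(2)] \<psi>_iff su sv u v by blast+
    then have "\<psi> (s (\<psi> u) @ s (\<psi> v)) = \<psi> (u @ v)"
      using congruence_on_append[OF cong] \<psi>_iff[OF append_in[OF su sv] append_in[OF u v]] by simp
    then show ?thesis
      using n_in by (simp add: m_def)
  qed
  have obtain_word: "\<exists>u\<in>A. a = \<psi> u" if "a \<in> {1..n}" for a
    using that \<psi>_image by blast
  have \<psi>_in: "\<psi> u \<in> {1..n}" if "u \<in> A" for u
    using that \<psi>_image by blast
  have closed: "m a b \<in> {1..n}" if ab: "a \<in> {1..n}" "b \<in> {1..n}" for a b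
  proof -
    obtain u v where "u \<in> A" "a = \<psi> u" "v \<in> A" "b = \<psi> v"
      using ab obtain_word by meson
    then show ?thesis
      using m_\<psi> \<psi>_in append_in by metis
  qed
  have assoc: "m (m a b) c = m a (m b c)" if abc: "a \<in> {1..n}" "b \<in> {1..n}" "c \<in> {1..n}" for a b c
  proof -
    obtain u v w where "u \<in> A" "a = \<psi> u" "v \<in> A" "b = \<psi> v" "w \<in> A" "c = \<psi> w"
      using abc obtain_word by meson
    then show ?thesis
      using m_\<psi> append_in by simp
  qed
  have "m \<in> {1..n} \<rightarrow>\<^sub>E {1..n} \<rightarrow>\<^sub>E {1..n}"
  proof (rule PiE_I)
    fix a assume a: "a \<in> {1..n}"
    show "m a \<in> {1..n} \<rightarrow>\<^sub>E {1..n}"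
    proof (rule PiE_I)
      fix b assume "b \<notin> {1..n}"
      then show "m a b = undefined"
        using a unfolding m_def by (simp only: restrict_apply if_True if_False)
    qed (use closed[OF a] in blast)
  qed (simp only: m_def restrict_apply if_False)
  then have S: "m \<in> semigroup_tables n"
    using assoc by (simp add: semigroup_tables_def)

  have letter_in: "[i] \<in> A" if "i \<in> {1..k}" for i
    using that by (simp add: A_def)
  \<comment> \<open>No other generator letter lies in the class of \<open>[i]\<close>, because
    \<rho> identifies letters only when \<open>f\<close> does; longer words are larger
    anyway.\<close>
  have least_letter: "least_rep A \<phi> [i] = [i]" if i: "i \<in> {1..k}" for i
    unfolding least_rep_def
  proof (rule Least_equality)
    show "[i] \<in> A \<and> \<phi> [i] = \<phi> [i]"
      using letter_in[OF i] by simp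
    fix v assume v: "v \<in> A \<and> \<phi> v = \<phi> [i]"
    show "[i] \<le> v"
    proof (cases "length v > 1")
      case False
      then obtain j where j: "v = [j]"
        using v by (cases v) (auto simp: A_def)
      then have j_in: "j \<in> {1..k}"
        using v by (simp add: A_def)
      have "([g j], [g i]) \<in> \<rho>"
        using v j \<phi>_iff[of v "[i]"] letter_in[OF i] by simp
      then have "f (g j) = f (g i)"
        using letter_iff[OF g_in[OF j_in] g_in[OF i]] by simp
      then show ?thesis
        using f_g[OF j_in] f_g[OF i] j by simp
    qed (simp add: single_less_iff order_less_imp_le)
  qed
  \<comment> \<open>The words up to \<open>[i]\<close> in shortlex are \<open>[1], ..., [i]\<close>,
    each least in its class, so the rank of \<open>[i]\<close> is \<open>i\<close>. Thus the
    generators receive the numbers they should.\<close>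
  have \<psi>_letter: "\<psi> [i] = i" if i: "i \<in> {1..k}" for i
  proof -
    have "{v \<in> least_rep A \<phi> ` A. v \<le> [i]} = (\<lambda>j. [j]) ` {1..i}"
    proof (intro equalityI subsetI)
      fix v assume v: "v \<in> {v \<in> least_rep A \<phi> ` A. v \<le> [i]}"
      then have "v \<in> A"
        using least_rep_in by auto
      then have v_in: "v \<noteq> []" "set v \<subseteq> {1..k}"
        by (simp_all add: A_def)
      then obtain j where "v = [j]"
        using v by (cases v) (auto simp: Cons_le_Cons)
      then show "v \<in> (\<lambda>j. [j]) ` {1..i}"
        using v v_in by (auto simp: Cons_le_Cons)
    next
      fix v assume "v \<in> (\<lambda>j. [j]) ` {1..i}"
      then obtain j where j: "v = [j]" "j \<in> {1..i}"
        by blast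
      then have j_in: "j \<in> {1..k}"
        using i by simp
      have "v \<in> least_rep A \<phi> ` A"
        using least_letter[OF j_in] letter_in[OF j_in] j(1) by (metis imageI)
      then show "v \<in> {v \<in> least_rep A \<phi> ` A. v \<le> [i]}"
        using j by (auto simp: Cons_le_Cons)
    qed
    then have "\<psi> [i] = card ((\<lambda>j. [j]) ` {1..i})"
      using least_letter[OF i] by (simp add: \<psi>_def class_rank_def)
    then show ?thesis
      by (simp add: card_image inj_on_def)
  qed
  have product: "word_product m u = \<psi> u" if "u \<in> A" for u
  proof -
    have "u \<noteq> []" "set u \<subseteq> {1..k}"
      using that by (simp_all add: A_def)
    then show ?thesis
    proof (induction u rule: rev_nonempty_induct)
      case (single i)
      then show ?case
        using \<psi>_letter by simp
    next
      case (snoc i u)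
      then have "u \<in> A" "i \<in> {1..k}"
        by (simp_all add: A_def)
      then show ?case
        using snoc m_\<psi>[of u "[i]"] \<psi>_letter[of i] letter_in[of i] by (simp add: word_product_snoc)
    qed
  qed

  have "{1..k} \<subseteq> {1..n}"
    using \<psi>_letter letter_in \<psi>_in by (metis subsetI)
  then have "subsemigroup_generated m {1..k} = word_product m ` {u. u \<noteq> [] \<and> set u \<subseteq> {1..k}}"
    using closed assoc by (intro subsemigroup_generated_eq)
  also have "{u. u \<noteq> [] \<and> set u \<subseteq> {1..k}} = A"
    by (simp add: A_def set_eq_iff del: atLeastAtMost_iff)
  also have "word_product m ` A = {1..n}"
    using product \<psi>_image by (simp cong: image_cong)
  finally have C: "m \<in> C_tables n k"
    using S by (simp add: C_tables_def)
  \<comment> \<open>Evaluation in \<open>m\<close> has the same kernel as \<open>\<phi>\<close>, so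
    decompositions are the least words that defined the ranks. A larger rank then means a larger
    decomposition.\<close>
  have "kernel_on A (word_product m) = kernel_on A \<phi>"
    using product \<psi>_iff \<phi>_iff by (simp add: kernel_on_eq_iff)
  then have dec: "dec m k (\<psi> u) = least_rep A \<phi> u" if "u \<in> A" for u
    using that product[OF that] dec_word_product[of m k u] least_rep_cong by (metis A_def)
  have "m \<in> T_tables n k"
    unfolding T_tables_def
  proof (intro CollectI conjI allI impI C)
    fix i assume i: "k < i \<and> i < n"
    then obtain u v where u: "u \<in> A" "i = \<psi> u" and v: "v \<in> A" "Suc i = \<psi> v"
      using obtain_word[of i] obtain_word[of "Suc i"] by auto
    then have "least_rep A \<phi> u < least_rep A \<phi> v"
      using class_rank_less_iff[OF fin u(1) v(1)] by (simp flip: \<psi>_def)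
    then show "dec m k i < dec m k (Suc i)"
      using dec[OF u(1)] dec[OF v(1)] u(2) v(2) by simp
  qed
  moreover have "\<rho> = evaluation_kernel r f m"
    unfolding evaluation_kernel_def
  proof (rule equiv_eq_kernel_on[OF equiv])
    fix u v assume uv: "u \<in> free_semigroup r" "v \<in> free_semigroup r"
    note in_A = uv[THEN surjections_map_in[OF f], folded A_def]
    have "(u, v) \<in> \<rho> \<longleftrightarrow> (map g (map f u), map g (map f v)) \<in> \<rho>"
      using gf[OF uv(1)] gf[OF uv(2)] equiv by (meson equivE symE transE)
    then show "(u, v) \<in> \<rho> \<longleftrightarrow> word_product m (map f u) = word_product m (map f v)"
      using product[OF in_A(1)] product[OF in_A(2)] \<psi>_iff[OF in_A] by simp
  qed
  ultimately show ?thesis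
    using that by blast
qed

text \<open>Injectivity: \<open>map f\<close> reaches every word over \<open>{1..k}\<close>, so the
  pulled-back kernel determines the kernel of \<open>word_product m\<close>, which determines
  \<open>m\<close>.\<close>

lemma bij_betw_evaluation_kernel:
  assumes f: "f \<in> surjections {1..r} {1..k}" and n: "n \<ge> 1"
  shows "bij_betw (evaluation_kernel r f) (T_tables n k)
    {\<rho> \<in> congruences_of_index r n. letter_kernel r \<rho> = kernel_on {1..r} f}"
  unfolding bij_betw_def
proof (intro conjI equalityI subsetI)
  show "inj_on (evaluation_kernel r f) (T_tables n k)"
  proof (rule inj_onI)
    fix m m'
    assume m: "m \<in> T_tables n k" "m' \<in> T_tables n k"
      and eq: "evaluation_kernel r f m = evaluation_kernel r f m'"
    have "kernel_on (free_semigroup k) (word_product m) = kernel_on (free_semigroup k) (word_product m')"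
      using eq unfolding evaluation_kernel_def kernel_on_eq_iff surjections_map_image[OF f, symmetric]
      by blast
    then show "m = m'"
      by (rule T_tables_eqI[OF m])
  qed
next
  fix \<rho> assume "\<rho> \<in> evaluation_kernel r f ` T_tables n k"
  then obtain m where "m \<in> C_tables n k" "\<rho> = evaluation_kernel r f m"
    by (auto simp: T_tables_def)
  then show "\<rho> \<in> {\<rho> \<in> congruences_of_index r n. letter_kernel r \<rho> = kernel_on {1..r} f}"
    using evaluation_kernel_in[OF f] by simp
next
  fix \<rho> assume "\<rho> \<in> {\<rho> \<in> congruences_of_index r n. letter_kernel r \<rho> = kernel_on {1..r} f}"
  then show "\<rho> \<in> evaluation_kernel r f ` T_tables n k"
    using T_tables_evaluation_kernel_exists[OF f n, of \<rho>] by blast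
qed

section \<open>Counting congruences by their number of letter classes\<close>

definition congruences_with_letter_classes :: "nat \<Rightarrow> nat \<Rightarrow> nat \<Rightarrow> (nat list \<times> nat list) set set" where
  "congruences_with_letter_classes r n k =
     {\<rho> \<in> congruences_of_index r n. card ({1..r} // letter_kernel r \<rho>) = k}"

lemma finite_T_tables: "finite (T_tables n k)"
proof (rule finite_subset)
  show "T_tables n k \<subseteq> {1..n} \<rightarrow>\<^sub>E {1..n} \<rightarrow>\<^sub>E {1..n}"
    unfolding T_tables_def C_tables_def semigroup_tables_def by blast
qed (simp add: finite_PiE)

text \<open>There are \<open>fact k\<close> such surjections, a non-zero number.\<close>

lemma congruences_with_letter_classes_surjection:
  assumes "\<rho> \<in> congruences_with_letter_classes r n k"
  shows "\<exists>f\<in>surjections {1..r} {1..k}. kernel_on {1..r} f = letter_kernel r \<rho>"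
proof -
  have "equiv {1..r} (letter_kernel r \<rho>)" and "card ({1..r} // letter_kernel r \<rho>) = card {1..k}"
    using assms equiv_letter_kernel
    by (auto simp: congruences_with_letter_classes_def congruences_of_index_def)
  from card_surjections_with_kernel[OF _ _ this]
  have "card {f \<in> surjections {1..r} {1..k}. kernel_on {1..r} f = letter_kernel r \<rho>} \<noteq> 0"
    by simp
  then have "{f \<in> surjections {1..r} {1..k}. kernel_on {1..r} f = letter_kernel r \<rho>} \<noteq> {}"
    by (metis card.empty)
  then show ?thesis
    by blast
qed

text \<open>Each of these congruences comes from one of finitely many pairs of a surjection and a
  table.\<close>

lemma finite_congruences_with_letter_classes:
  assumes "n \<ge> 1"
  shows "finite (congruences_with_letter_classes r n k)"
proof (rule finite_subset)
  show "congruences_with_letter_classes r n k \<subseteq>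
    (\<Union>f\<in>surjections {1..r} {1..k}. evaluation_kernel r f ` T_tables n k)"
  proof
    fix \<rho> assume \<rho>: "\<rho> \<in> congruences_with_letter_classes r n k"
    obtain f where f: "f \<in> surjections {1..r} {1..k}" "kernel_on {1..r} f = letter_kernel r \<rho>"
      using congruences_with_letter_classes_surjection[OF \<rho>] by blast
    have "\<rho> \<in> evaluation_kernel r f ` T_tables n k"
      unfolding bij_betw_imp_surj_on[OF bij_betw_evaluation_kernel[OF f(1) assms]]
      using \<rho> f(2) by (simp add: congruences_with_letter_classes_def)
    then show "\<rho> \<in> (\<Union>f\<in>surjections {1..r} {1..k}. evaluation_kernel r f ` T_tables n k)"
      using f(1) by blast
  qed
qed (simp add: finite_surjections finite_T_tables)

text \<open>Double counting of the pairs of a congruence and a surjection onto \<open>{1..k}\<close> with the same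
  kernel on letters.\<close>

lemma card_congruences_with_letter_classes:
  assumes "n \<ge> 1"
  shows "card (surjections {1..r} {1..k}) * card (T_tables n k) =
    fact k * card (congruences_with_letter_classes r n k)"
proof -
  let ?R = "congruences_with_letter_classes r n k" and ?S = "surjections {1..r} {1..k}"
  have "card (T_tables n k) = card {\<rho> \<in> ?R. letter_kernel r \<rho> = kernel_on {1..r} f}" if f: "f \<in> ?S" for f
  proof -
    \<comment> \<open>Sharing the letter kernel of \<open>f\<close> already forces \<open>k\<close>
      letter classes, so restricting to \<open>?R\<close> loses nothing.\<close>
    have "card ({1..r} // kernel_on {1..r} f) = k"
      using f by (simp add: card_quotient_kernel_on surjections_def)
    then have "{\<rho> \<in> ?R. letter_kernel r \<rho> = kernel_on {1..r} f} =
        {\<rho> \<in> congruences_of_index r n. letter_kernel r \<rho> = kernel_on {1..r} f}"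
      by (auto simp: congruences_with_letter_classes_def)
    then show ?thesis
      using bij_betw_same_card[OF bij_betw_evaluation_kernel[OF f assms]] by simp
  qed
  then have "(\<Sum>f\<in>?S. card (T_tables n k)) =
      (\<Sum>f\<in>?S. card {\<rho> \<in> ?R. letter_kernel r \<rho> = kernel_on {1..r} f})"
    by (rule sum.cong[OF refl])
  then have "card ?S * card (T_tables n k) =
      (\<Sum>f\<in>?S. card {\<rho> \<in> ?R. letter_kernel r \<rho> = kernel_on {1..r} f})"
    by simp
  also have "\<dots> = fact k * card ?R"
  proof (rule sum_multicount)
    show "\<forall>\<rho>\<in>?R. card {f \<in> ?S. letter_kernel r \<rho> = kernel_on {1..r} f} = fact k"
    proof
      fix \<rho> assume "\<rho> \<in> ?R"
      then have "equiv {1..r} (letter_kernel r \<rho>)" and "card ({1..r} // letter_kernel r \<rho>) = card {1..k}"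
        using equiv_letter_kernel
        by (auto simp: congruences_with_letter_classes_def congruences_of_index_def)
      from card_surjections_with_kernel[OF _ _ this]
      show "card {f \<in> ?S. letter_kernel r \<rho> = kernel_on {1..r} f} = fact k"
        by (simp add: eq_commute[of "letter_kernel r \<rho>"])
    qed
    show "finite ?S"
      by (simp add: finite_surjections)
    show "finite ?R"
      using assms by (rule finite_congruences_with_letter_classes)
  qed
  finally show ?thesis .
qed

text \<open>With \<open>r \<ge> 1\<close> there is at least one letter class. There are at most
  \<open>n\<close>, because a table on \<open>{1..n}\<close> containing \<open>{1..k}\<close>
  realises the congruence.\<close>

lemma congruences_of_index_eq_Union:
  assumes "n \<ge> 1" and "r \<ge> 1"
  shows "congruences_of_index r n = (\<Union>k\<in>{1..n}. congruences_with_letter_classes r n k)"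
proof (intro equalityI subsetI)
  fix \<rho> assume \<rho>: "\<rho> \<in> congruences_of_index r n"
  define k where "k = card ({1..r} // letter_kernel r \<rho>)"
  have in_k: "\<rho> \<in> congruences_with_letter_classes r n k"
    using \<rho> by (simp add: congruences_with_letter_classes_def k_def)
  then obtain f where f: "f \<in> surjections {1..r} {1..k}" "kernel_on {1..r} f = letter_kernel r \<rho>"
    using congruences_with_letter_classes_surjection by blast
  then have "f ` {1..r} = {1..k}"
    by (simp add: surjections_def)
  then have "{1..k} \<noteq> {}"
    using assms(2) by (metis atLeastatMost_empty_iff2 image_is_empty not_le)
  moreover obtain m where "m \<in> T_tables n k"
    using T_tables_evaluation_kernel_exists[OF f(1) assms(1) \<rho>] f(2) by metis
  then have "{1..k} \<subseteq> {1..n}"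
    using C_tables_le by (auto simp: T_tables_def)
  ultimately have "k \<in> {1..n}"
    by auto
  then show "\<rho> \<in> (\<Union>k\<in>{1..n}. congruences_with_letter_classes r n k)"
    using in_k by blast
qed (auto simp: congruences_with_letter_classes_def)

section \<open>Summation over the number of letter classes\<close>

theorem theorem7p8:
  fixes n r :: nat
  assumes "n \<ge> 1" and "r \<ge> 1"
  shows "real (congruence_growth r n) =
    (\<Sum>j=1..n. (\<Sum>k=j..n. (-1) ^ (k - j) * real (k choose j) * (real (card (T_tables n k)) / fact k))
                * real j ^ r)"
proof -
  let ?R = "congruences_with_letter_classes r n"
  have R: "real (card (?R k)) =
      (\<Sum>j\<in>{j \<in> {1..n}. j \<le> k}.
        (-1) ^ (k - j) * real (k choose j) * (real (card (T_tables n k)) / fact k) * real j ^ r)"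
    if k: "k \<in> {1..n}" for k
  proof -
    have "real (card (surjections {1..r} {1..k})) =
        (\<Sum>j=0..k. (-1) ^ (k - j) * real (k choose j) * real j ^ r)"
      using card_surjections[of "{1..r}" "{1..k}"] by simp
    \<comment> \<open>The term \<open>j = 0\<close> vanishes as \<open>r \<ge> 1\<close>. The index
      set is written as a restriction of \<open>{1..n}\<close> to prepare the exchange of
      sums.\<close>
    also have "\<dots> = (\<Sum>j\<in>{j \<in> {1..n}. j \<le> k}. (-1) ^ (k - j) * real (k choose j) * real j ^ r)"
      using k assms(2) by (intro sum.mono_neutral_right) (auto simp: power_0_left not_less_eq_eq)
    finally have surj: "real (card (surjections {1..r} {1..k})) = \<dots>" .
    \<comment> \<open>The double count is divided by \<open>fact k\<close>.\<close>
    have "real (card (surjections {1..r} {1..k}) * card (T_tables n k)) = real (fact k * card (?R k))"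
      by (simp only: card_congruences_with_letter_classes[OF assms(1)])
    then have "real (card (?R k)) =
        real (card (surjections {1..r} {1..k})) * (real (card (T_tables n k)) / fact k)"
      by (simp add: field_simps)
    then show ?thesis
      unfolding surj sum_distrib_right by (simp add: mult_ac)
  qed
  have "congruence_growth r n = card (\<Union>k\<in>{1..n}. ?R k)"
    using congruences_of_index_eq_Union[OF assms]
    by (simp add: congruence_growth_def congruences_of_index_def)
  also have "\<dots> = (\<Sum>k=1..n. card (?R k))"
    using finite_congruences_with_letter_classes[OF assms(1)]
    by (intro card_UN_disjoint) (auto simp: congruences_with_letter_classes_def)
  finally have "real (congruence_growth r n) = (\<Sum>k=1..n. real (card (?R k)))"
    by simp
  also have "\<dots> = (\<Sum>k=1..n. \<Sum>j\<in>{j \<in> {1..n}. j \<le> k}.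
        (-1) ^ (k - j) * real (k choose j) * (real (card (T_tables n k)) / fact k) * real j ^ r)"
    by (rule sum.cong[OF refl R])
  also have "\<dots> = (\<Sum>j=1..n. \<Sum>k\<in>{k \<in> {1..n}. j \<le> k}.
        (-1) ^ (k - j) * real (k choose j) * (real (card (T_tables n k)) / fact k) * real j ^ r)"
    by (rule sum.swap_restrict) simp_all
  also have "\<dots> = (\<Sum>j=1..n. (\<Sum>k=j..n. (-1) ^ (k - j) * real (k choose j) *
        (real (card (T_tables n k)) / fact k)) * real j ^ r)"
  proof (rule sum.cong[OF refl])
    fix j assume "j \<in> {1..n}"
    then have "{k \<in> {1..n}. j \<le> k} = {j..n}"
      by auto
    then show "(\<Sum>k\<in>{k \<in> {1..n}. j \<le> k}.
        (-1) ^ (k - j) * real (k choose j) * (real (card (T_tables n k)) / fact k) * real j ^ r) =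
      (\<Sum>k=j..n. (-1) ^ (k - j) * real (k choose j) * (real (card (T_tables n k)) / fact k)) * real j ^ r"
      by (simp only: sum_distrib_right)
  qed
  finally show ?thesis .
qed

end
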